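(* Let $N\ge 2$ be fixed and let $(\theta_t)_{t\ge 0}$ be the ACCA dynamics on the open path with $N$ vertices, started from an arbitrary initial configuration $\theta_0\in[-\pi,\pi)^N$. Then \[ \lim_{t\to\infty}\ \sum_{i=1}^{N-1}|\delta_t(i)|=0\qquad\text{almost surely}. \] In particular, strong consensus holds almost surely.
   Context: For $a\in\mathbb R$ let $\operatorname{wrap}_\pi(a):=a-2\pi\lfloor\frac{a+\pi}{2\pi}\rfloor\in[-\pi,\pi)$. The circle $\mathbb S^1$ is identified with $[-\pi,\pi)$, i.e. with $\mathbb R/2\pi\mathbb Z$. The open path has vertex set $\{1,\dots,N\}$ and edges $(i,i+1)$, $1\le i\le N-1$. A configuration is $\theta\in[-\pi,\pi)^N$, and $\delta_t(i):=\operatorname{wrap}_\pi(\theta_t(i+1)-\theta_t(i))$ for $1\le i\le N-1$. ACCA dynamics (discrete time Markov chain): at each step $t\to t+1$ an edge $(k,k+1)$ is chosen uniformly at random among all edges, independently of the past, and \[ \theta_{t+1}(k)=\operatorname{wrap}_\pi\big(\theta_t(k)+\tfrac12\delta_t(k)\big),\qquad \theta_{t+1}(k+1)=\operatorname{wrap}_\pi\big(\theta_t(k+1)-\tfrac12\delta_t(k)\big), \] while $\theta_{t+1}(i)=\theta_t(i)$ for $i\notin\{k,k+1\}$ (these two new values coincide: both are the midpoint along the shortest arc). If $\delta_t(k)=-\pi$ (antipodal case), the common new value at $k$ and $k+1$ is instead chosen, with probability $1/2$ each and independently, between the two midpoints $\operatorname{wrap}_\pi(\theta_t(k)+\tfrac{\pi}{2})$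 and $\operatorname{wrap}_\pi(\theta_t(k)-\tfrac{\pi}{2})$. Strong consensus means: there is a random $L\in\mathbb S^1$ such that $\theta_t(v)\to L$ in $\mathbb S^1$ as $t\to\infty$ for all vertices $v$. *)

theory Defs
  imports "HOL-Probability.Probability"
begin

definition wrap_pi :: "real \<Rightarrow> real" where
  "wrap_pi a = a - 2 * pi * of_int \<lfloor>(a + pi) / (2 * pi)\<rfloor>"

abbreviation circle :: "real set" where
  "circle \<equiv> {- pi..<pi}"

text \<open>Geodesic distance on the reals modulo \<open>2\<pi>\<close>; it induces the topology of the circle, in which
  points of the half-open interval close to \<open>pi\<close> are close to \<open>-pi\<close>.\<close>

definition circle_dist :: "real \<Rightarrow> real \<Rightarrow> real" where
  "circle_dist a b = \<bar>wrap_pi (a - b)\<bar>"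

text \<open>The circle carries its Borel sets, which are those of the half-open interval.\<close>

definition circle_borel :: "real measure" where
  "circle_borel = restrict_space borel circle"

text \<open>The path has vertices \<open>{1..N}\<close>; its edge \<open>(k, k + 1)\<close> is denoted by \<open>k\<close>, with
  \<open>k \<in> {1..N - 1}\<close>.\<close>

definition configs :: "nat \<Rightarrow> (nat \<Rightarrow> real) set" where
  "configs N = {1..N} \<rightarrow>\<^sub>E circle"

definition config_space :: "nat \<Rightarrow> (nat \<Rightarrow> real) measure" where
  "config_space N = (\<Pi>\<^sub>M i\<in>{1..N}. circle_borel)"

definition delta :: "(nat \<Rightarrow> real) \<Rightarrow> nat \<Rightarrow> real" where
  "delta \<theta> i = wrap_pi (\<theta> (i + 1) - \<theta> i)"

text \<open>The transition kernel: the law of the configuration after one step from \<open>\<theta>\<close>.\<close>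

definition acca_kernel :: "nat \<Rightarrow> (nat \<Rightarrow> real) \<Rightarrow> (nat \<Rightarrow> real) pmf" where
  "acca_kernel N \<theta> =
     bind_pmf (pmf_of_set {1..N - 1}) (\<lambda>k.
       if delta \<theta> k = - pi then
         map_pmf
           (\<lambda>b. let m = (if b then wrap_pi (\<theta> k + pi / 2) else wrap_pi (\<theta> k - pi / 2))
                in \<theta>(k := m, k + 1 := m))
           (bernoulli_pmf (1 / 2))
       else
         return_pmf
           (\<theta>(k := wrap_pi (\<theta> k + delta \<theta> k / 2),
              k + 1 := wrap_pi (\<theta> (k + 1) - delta \<theta> k / 2))))"

text \<open>\<open>X\<close> is a Markov chain on the probability space \<open>M\<close>, started in \<open>\<theta>0\<close>, with the above transition
  kernel. Since the initial state is deterministic and every transition has finite support, almost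
  surely only countably many configurations are ever visited, so the elementary form of the Markov
  property (with the conditional probability multiplied out) determines the law of \<open>X\<close>.\<close>

definition acca_dynamics ::
  "'a measure \<Rightarrow> nat \<Rightarrow> (nat \<Rightarrow> real) \<Rightarrow> (nat \<Rightarrow> 'a \<Rightarrow> nat \<Rightarrow> real) \<Rightarrow> bool" where
  "acca_dynamics M N \<theta>0 X \<longleftrightarrow>
     prob_space M \<and>
     (\<forall>t. X t \<in> measurable M (config_space N)) \<and>
     (AE \<omega> in M. X 0 \<omega> = \<theta>0) \<and>
     (\<forall>t x. measure M {\<omega> \<in> space M. \<forall>s\<le>Suc t. X s \<omega> = x s} =
        measure M {\<omega> \<in> space M. \<forall>s\<le>t. X s \<omega> = x s} * pmf (acca_kernel N (x t)) (x (Suc t)))"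

definition strong_consensus :: "'a measure \<Rightarrow> nat \<Rightarrow> (nat \<Rightarrow> 'a \<Rightarrow> nat \<Rightarrow> real) \<Rightarrow> bool" where
  "strong_consensus M N X \<longleftrightarrow>
     (\<exists>L \<in> measurable M circle_borel.
        AE \<omega> in M. \<forall>v\<in>{1..N}. (\<lambda>t. circle_dist (X t \<omega> v) (L \<omega>)) \<longlonglongrightarrow> 0)"

end

theory Submission
  imports Defs
begin

text \<open>Averaging along the edge \<open>k\<close> sets \<open>delta k\<close> to zero and moves at most half of its absolute value
  to each neighbouring edge, since wrapping never increases absolute values. Hence the weighted
  variation \<open>\<Sum> i (N - i) \<bar>delta i\<bar>\<close> decreases by at least \<open>\<bar>delta k\<bar>\<close>, so its expectation decreases in
  each step by at least \<open>1 / (N - 1)\<close> times the expected total variation. Therefore the total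
  variations are almost surely summable over time, and in particular tend to zero. As the angle of a
  vertex moves in each step by at most the current total variation, its lift to the real line
  converges; the limit is common to all vertices because the differences vanish.\<close>

section \<open>Arithmetic modulo \<open>2 * pi\<close>\<close>

lemma wrap_pi_add_period: "wrap_pi (a + 2 * pi * of_int n) = wrap_pi a"
proof -
  have "(a + 2 * pi * of_int n + pi) / (2 * pi) = (a + pi) / (2 * pi) + of_int n"
    by (simp add: field_simps)
  then have "\<lfloor>(a + 2 * pi * of_int n + pi) / (2 * pi)\<rfloor> = \<lfloor>(a + pi) / (2 * pi)\<rfloor> + n"
    by (metis floor_add_int)
  then show ?thesis
    unfolding wrap_pi_def by (simp add: algebra_simps)
qed

lemma wrap_pi_eq: "\<exists>n. wrap_pi a = a + 2 * pi * of_int n"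
  unfolding wrap_pi_def by (rule exI[of _ "- \<lfloor>(a + pi) / (2 * pi)\<rfloor>"]) simp

lemma wrap_pi_cong: "a = b + 2 * pi * of_int n \<Longrightarrow> wrap_pi a = wrap_pi b"
  using wrap_pi_add_period by simp

text \<open>This and the following simp rules strip inner wraps, so that an identity on the circle
  reduces to an identity of reals under one outer \<open>wrap_pi\<close>.\<close>

lemma wrap_pi_add_left [simp]: "wrap_pi (wrap_pi a + b) = wrap_pi (a + b)"
proof -
  obtain n where "wrap_pi a = a + 2 * pi * of_int n" using wrap_pi_eq by blast
  then show ?thesis by (intro wrap_pi_cong[where n = n]) simp
qed

lemma wrap_pi_add_right [simp]: "wrap_pi (a + wrap_pi b) = wrap_pi (a + b)"
  by (metis add.commute wrap_pi_add_left)

lemma wrap_pi_diff_left [simp]: "wrap_pi (wrap_pi a - b) = wrap_pi (a - b)"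
  using wrap_pi_add_left[of a "- b"] by simp

lemma wrap_pi_diff_right [simp]: "wrap_pi (a - wrap_pi b) = wrap_pi (a - b)"
proof -
  obtain n where "wrap_pi b = b + 2 * pi * of_int n" using wrap_pi_eq by blast
  then show ?thesis by (intro wrap_pi_cong[where n = "- n"]) simp
qed

lemma wrap_pi_idem [simp]: "wrap_pi (wrap_pi a) = wrap_pi a"
  using wrap_pi_add_left[of a 0] by simp

lemma wrap_pi_in_circle: "wrap_pi a \<in> circle"
proof -
  define y where "y = (a + pi) / (2 * pi)"
  have a: "a = 2 * pi * y - pi" by (simp add: y_def field_simps)
  \<comment> \<open>Up to scaling and shifting, \<open>wrap_pi a\<close> is the fractional part of
    \<open>y\<close>.\<close>
  have "wrap_pi a = 2 * pi * (y - of_int \<lfloor>y\<rfloor>) - pi"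
    unfolding wrap_pi_def y_def[symmetric] by (subst a) (simp add: algebra_simps)
  moreover have "0 \<le> y - of_int \<lfloor>y\<rfloor>" "y - of_int \<lfloor>y\<rfloor> < 1" by linarith+
  moreover have "2 * pi * (y - of_int \<lfloor>y\<rfloor>) < 2 * pi * 1"
    using calculation by (intro mult_strict_left_mono) auto
  ultimately show ?thesis by simp
qed

lemma wrap_pi_circle: "a \<in> circle \<Longrightarrow> wrap_pi a = a"
proof -
  assume "a \<in> circle"
  then have "\<lfloor>(a + pi) / (2 * pi)\<rfloor> = 0"
    by (intro floor_unique) (auto simp: field_simps)
  then show ?thesis by (simp add: wrap_pi_def)
qed

lemma wrap_pi_0 [simp]: "wrap_pi 0 = 0"
  by (simp add: wrap_pi_circle)

lemma abs_wrap_pi_le_pi: "\<bar>wrap_pi a\<bar> \<le> pi"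
  using wrap_pi_in_circle[of a] by (auto simp: abs_le_iff)

text \<open>Inside \<open>circle\<close> wrapping is the identity; outside,
  \<open>\<bar>a\<bar>\<close> is at least \<open>pi\<close>, which bounds every wrapped
  value.\<close>

lemma abs_wrap_pi_le: "\<bar>wrap_pi a\<bar> \<le> \<bar>a\<bar>"
proof (cases "a \<in> circle")
  case True
  then show ?thesis by (simp add: wrap_pi_circle)
next
  case False
  then have "pi \<le> \<bar>a\<bar>" by auto
  then show ?thesis using abs_wrap_pi_le_pi[of a] by linarith
qed

text \<open>The triangle inequality of the geodesic distance: wrap both summands first, then use
  that the outer wrap does not increase absolute values.\<close>

lemma abs_wrap_pi_add: "\<bar>wrap_pi (a + b)\<bar> \<le> \<bar>wrap_pi a\<bar> + \<bar>wrap_pi b\<bar>"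
  using abs_wrap_pi_le[of "wrap_pi a + wrap_pi b"] by simp

lemma borel_measurable_wrap_pi [measurable]: "wrap_pi \<in> borel_measurable borel"
  unfolding wrap_pi_def by measurable

section \<open>Total variation and its weighted version\<close>

definition total_variation :: "nat \<Rightarrow> (nat \<Rightarrow> real) \<Rightarrow> real" where
  "total_variation N \<theta> = (\<Sum>i = 1..N - 1. \<bar>delta \<theta> i\<bar>)"

text \<open>The weights \<open>i (N - i)\<close> vanish at both ends of the path and have constant second difference
  \<open>-2\<close>; strict concavity is what makes every averaging step decrease this quantity.\<close>

definition potential :: "nat \<Rightarrow> (nat \<Rightarrow> real) \<Rightarrow> real" where
  "potential N \<theta> = (\<Sum>i = 0..N. real i * (real N - real i) * \<bar>delta \<theta> i\<bar>)"

lemma total_variation_nonneg: "0 \<le> total_variation N \<theta>"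
  by (simp add: total_variation_def sum_nonneg)

lemma potential_nonneg: "0 \<le> potential N \<theta>"
  unfolding potential_def by (intro sum_nonneg) auto

text \<open>Edge \<open>k\<close> becomes flat and each neighbouring edge gains at most half of
  \<open>\<bar>delta \<theta> k\<bar>\<close>, so the change is governed by half the second
  difference of the weights, which is -1. Since the sum runs over \<open>{0..N}\<close>, edges 1 and
  \<open>N - 1\<close> also have two neighbours; the fictitious edges 0 and \<open>N\<close> carry
  weight 0. Leaving the sign of \<open>h\<close> free covers both antipodal outcomes.\<close>

lemma potential_update_le:
  assumes k: "k \<in> {1..N - 1}"
    and h: "\<bar>h\<bar> = \<bar>delta \<theta> k\<bar> / 2"
    and m: "wrap_pi m = wrap_pi (\<theta> k + h)" "wrap_pi m = wrap_pi (\<theta> (k + 1) - h)"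
  shows "potential N (\<theta>(k := m, k + 1 := m)) \<le> potential N \<theta> - \<bar>delta \<theta> k\<bar>"
proof -
  obtain j where j: "k = Suc j" using k by (cases k) auto
  define \<theta>' where "\<theta>' = \<theta>(k := m, k + 1 := m)"
  define w where "w i = real i * (real N - real i)" for i
  \<comment> \<open>\<open>c i\<close> bounds the change of the summand at \<open>i\<close>; here
    \<open>j = k - 1\<close>.\<close>
  define c where "c i = (if i = k then - w k * \<bar>delta \<theta> k\<bar>
      else if i = j \<or> i = k + 1 then w i * \<bar>h\<bar> else 0)" for i
  have w: "0 \<le> w i" if "i \<le> N" for i using that by (simp add: w_def)
  have le: "w i * \<bar>delta \<theta>' i\<bar> \<le> w i * \<bar>delta \<theta> i\<bar> + c i" if "i \<in> {0..N}" for i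
  proof -
    consider "i = k" | "i = j" | "i = k + 1" | "i \<noteq> k" "i \<noteq> j" "i \<noteq> k + 1" by blast
    then show ?thesis
    proof cases
      case 1
      then show ?thesis by (simp add: \<theta>'_def delta_def c_def)
    next
      case 2
      have "delta \<theta>' j = wrap_pi (wrap_pi m - \<theta> j)"
        by (simp add: \<theta>'_def delta_def j)
      also have "\<dots> = wrap_pi ((\<theta> k - \<theta> j) + h)"
        by (simp add: m(1) algebra_simps)
      finally have "\<bar>delta \<theta>' j\<bar> \<le> \<bar>delta \<theta> j\<bar> + \<bar>h\<bar>"
        using abs_wrap_pi_add[of "\<theta> k - \<theta> j" h] abs_wrap_pi_le[of h] by (simp add: delta_def j)
      from mult_left_mono[OF this w[of j]] show ?thesis
        using that 2 by (simp add: c_def j algebra_simps)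
    next
      case 3
      have "delta \<theta>' (k + 1) = wrap_pi (\<theta> (k + 2) - wrap_pi m)"
        by (simp add: \<theta>'_def delta_def)
      also have "\<dots> = wrap_pi ((\<theta> (k + 2) - \<theta> (k + 1)) + h)"
        by (simp add: m(2) algebra_simps)
      finally have "\<bar>delta \<theta>' (k + 1)\<bar> \<le> \<bar>delta \<theta> (k + 1)\<bar> + \<bar>h\<bar>"
        using abs_wrap_pi_add[of "\<theta> (k + 2) - \<theta> (k + 1)" h] abs_wrap_pi_le[of h]
        by (simp add: delta_def)
      from mult_left_mono[OF this w[of "k + 1"]] show ?thesis
        using that 3 by (simp add: c_def j algebra_simps)
    next
      case 4
      then have "delta \<theta>' i = delta \<theta> i" by (simp add: \<theta>'_def delta_def j)
      then show ?thesis using 4 by (simp add: c_def)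
    qed
  qed
  have "sum c {0..N} = sum c {j, k, k + 1}"
    using k by (intro sum.mono_neutral_right) (auto simp: c_def j)
  also have "\<dots> = w j * \<bar>h\<bar> - w k * \<bar>delta \<theta> k\<bar> + w (k + 1) * \<bar>h\<bar>"
    by (simp add: c_def j)
  \<comment> \<open>\<open>w j + w (k + 1) = 2 * w k - 2\<close>.\<close>
  also have "\<dots> = - \<bar>delta \<theta> k\<bar>"
    unfolding h by (simp add: w_def j field_simps)
  finally have c: "sum c {0..N} = - \<bar>delta \<theta> k\<bar>" .
  have "potential N \<theta>' \<le> (\<Sum>i = 0..N. w i * \<bar>delta \<theta> i\<bar> + c i)"
    unfolding potential_def w_def[symmetric] by (intro sum_mono le)
  also have "\<dots> = potential N \<theta> - \<bar>delta \<theta> k\<bar>"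
    by (simp add: sum.distrib c potential_def w_def)
  finally show ?thesis by (simp add: \<theta>'_def)
qed

section \<open>One step of the chain\<close>

definition edge_step :: "(nat \<Rightarrow> real) \<Rightarrow> nat \<Rightarrow> (nat \<Rightarrow> real) pmf" where
  "edge_step \<theta> k = (if delta \<theta> k = - pi then
         map_pmf
           (\<lambda>b. let m = (if b then wrap_pi (\<theta> k + pi / 2) else wrap_pi (\<theta> k - pi / 2))
                in \<theta>(k := m, k + 1 := m))
           (bernoulli_pmf (1 / 2))
       else
         return_pmf
           (\<theta>(k := wrap_pi (\<theta> k + delta \<theta> k / 2),
              k + 1 := wrap_pi (\<theta> (k + 1) - delta \<theta> k / 2))))"

lemma acca_kernel_eq_bind: "acca_kernel N \<theta> = bind_pmf (pmf_of_set {1..N - 1}) (edge_step \<theta>)"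
  by (simp add: acca_kernel_def edge_step_def[abs_def])

text \<open>Brings the regular and the antipodal case into one form: both endpoints move to the same
  point, by \<open>h\<close> and \<open>- h\<close>. Here \<open>h\<close> is
  \<open>delta \<theta> k / 2\<close> in the regular case and \<open>pi / 2\<close> or
  \<open>- pi / 2\<close> in the antipodal one.\<close>

lemma edge_step_cases:
  assumes "\<theta>' \<in> set_pmf (edge_step \<theta> k)"
  obtains h m where "\<bar>h\<bar> = \<bar>delta \<theta> k\<bar> / 2" "wrap_pi m = wrap_pi (\<theta> k + h)"
    "wrap_pi m = wrap_pi (\<theta> (k + 1) - h)" "\<theta>' = \<theta>(k := m, k + 1 := m)"
proof -
  obtain n where n: "delta \<theta> k = \<theta> (k + 1) - \<theta> k + 2 * pi * of_int n"
    using wrap_pi_eq unfolding delta_def by blast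
  show ?thesis
  proof (cases "delta \<theta> k = - pi")
    case False
    then have \<theta>': "\<theta>' = \<theta>(k := wrap_pi (\<theta> k + delta \<theta> k / 2),
        k + 1 := wrap_pi (\<theta> (k + 1) - delta \<theta> k / 2))"
      using assms by (simp add: edge_step_def)
    have eq: "wrap_pi (\<theta> (k + 1) - delta \<theta> k / 2) = wrap_pi (\<theta> k + delta \<theta> k / 2)"
      using n by (intro wrap_pi_cong[where n = "- n"]) (simp add: field_simps)
    show ?thesis
      by (rule that[of "delta \<theta> k / 2" "wrap_pi (\<theta> k + delta \<theta> k / 2)"]) (simp_all only: eq \<theta>' wrap_pi_idem abs_divide abs_numeral)
  next
    case True
    \<comment> \<open>Antipodality makes the two endpoints differ by \<open>pi\<close> modulo
      \<open>2 * pi\<close>, so the midpoints seen from either end agree; this one needs an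
      additional full turn, hence \<open>- n - 1\<close>.\<close>
    have p: "wrap_pi (\<theta> (k + 1) - pi / 2) = wrap_pi (\<theta> k + pi / 2)"
      using n True by (intro wrap_pi_cong[where n = "- n - 1"]) (simp add: field_simps)
    have m: "wrap_pi (\<theta> (k + 1) + pi / 2) = wrap_pi (\<theta> k - pi / 2)"
      using n True by (intro wrap_pi_cong[where n = "- n"]) (simp add: field_simps)
    from assms True obtain b where
      "\<theta>' = (let m = (if b then wrap_pi (\<theta> k + pi / 2) else wrap_pi (\<theta> k - pi / 2))
                in \<theta>(k := m, k + 1 := m))"
      by (auto simp: edge_step_def)
    then show ?thesis
      using that[of "pi / 2" "wrap_pi (\<theta> k + pi / 2)"]
        that[of "- pi / 2" "wrap_pi (\<theta> k - pi / 2)"] True p m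
      by (cases b) (simp_all add: Let_def)
  qed
qed

text \<open>The drift inequality: the decrease \<open>\<bar>delta \<theta> k\<bar>\<close> is
  averaged over the \<open>N - 1\<close> equally likely edges. Stated as a sum, it avoids the
  truncated subtraction of \<open>ennreal\<close>.\<close>

lemma nn_integral_potential_kernel:
  assumes N: "N \<ge> 2"
  shows "(\<integral>\<^sup>+ y. ennreal (potential N y) \<partial>acca_kernel N \<theta>)
      + ennreal (total_variation N \<theta> / real (N - 1)) \<le> ennreal (potential N \<theta>)"
proof -
  have dec: "0 \<le> potential N \<theta> - \<bar>delta \<theta> k\<bar> \<and>
      (\<integral>\<^sup>+ y. ennreal (potential N y) \<partial>edge_step \<theta> k) \<le> ennreal (potential N \<theta> - \<bar>delta \<theta> k\<bar>)"
    if k: "k \<in> {1..N - 1}" for k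
  proof -
    have le: "potential N y \<le> potential N \<theta> - \<bar>delta \<theta> k\<bar>" if "y \<in> set_pmf (edge_step \<theta> k)" for y
      using that by (elim edge_step_cases) (use potential_update_le[OF k] in blast)
    obtain y where "y \<in> set_pmf (edge_step \<theta> k)" using set_pmf_not_empty by fast
    \<comment> \<open>Any possible outcome has nonnegative potential, so the bound is nonnegative
      and \<open>ennreal\<close> does not cut it off at 0.\<close>
    from le[OF this] potential_nonneg[of N y] have "0 \<le> potential N \<theta> - \<bar>delta \<theta> k\<bar>" by linarith
    moreover have "(\<integral>\<^sup>+ y. ennreal (potential N y) \<partial>edge_step \<theta> k)
        \<le> (\<integral>\<^sup>+ y. ennreal (potential N \<theta> - \<bar>delta \<theta> k\<bar>) \<partial>edge_step \<theta> k)"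
      using le by (intro nn_integral_mono_AE AE_pmfI ennreal_leI) auto
    ultimately show ?thesis by simp
  qed
  have ne: "finite {1..N - 1}" "{1..N - 1} \<noteq> {}" using N by auto
  have "(\<integral>\<^sup>+ y. ennreal (potential N y) \<partial>acca_kernel N \<theta>)
      \<le> (\<integral>\<^sup>+ k. ennreal (potential N \<theta> - \<bar>delta \<theta> k\<bar>) \<partial>pmf_of_set {1..N - 1})"
    unfolding acca_kernel_eq_bind nn_integral_bind_pmf
    using dec ne by (intro nn_integral_mono_AE AE_pmfI) auto
  also have "\<dots> = (\<Sum>k = 1..N - 1. ennreal (potential N \<theta> - \<bar>delta \<theta> k\<bar>)) / real (N - 1)"
    using nn_integral_pmf_of_set[OF ne(2,1)] by (simp add: ennreal_of_nat_eq_real_of_nat)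
  also have "\<dots> = ennreal ((\<Sum>k = 1..N - 1. potential N \<theta> - \<bar>delta \<theta> k\<bar>) / real (N - 1))"
    using dec N by (subst sum_ennreal) (auto intro!: divide_ennreal sum_nonneg)
  also have "(\<Sum>k = 1..N - 1. potential N \<theta> - \<bar>delta \<theta> k\<bar>) / real (N - 1)
      = potential N \<theta> - total_variation N \<theta> / real (N - 1)"
    using N by (simp add: sum_subtractf total_variation_def field_simps)
  finally have *: "(\<integral>\<^sup>+ y. ennreal (potential N y) \<partial>acca_kernel N \<theta>)
      \<le> ennreal (potential N \<theta> - total_variation N \<theta> / real (N - 1))" .
  have "0 \<le> (\<Sum>k = 1..N - 1. potential N \<theta> - \<bar>delta \<theta> k\<bar>) / real (N - 1)"
    using dec by (intro divide_nonneg_nonneg sum_nonneg) auto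
  also have "\<dots> = potential N \<theta> - total_variation N \<theta> / real (N - 1)"
    using N by (simp add: sum_subtractf total_variation_def field_simps)
  finally have "ennreal (potential N \<theta> - total_variation N \<theta> / real (N - 1))
      + ennreal (total_variation N \<theta> / real (N - 1)) = ennreal (potential N \<theta>)"
    using total_variation_nonneg[of N \<theta>] by (subst ennreal_plus[symmetric]) auto
  then show ?thesis using add_right_mono[OF *] by metis
qed

text \<open>Only the endpoints of the chosen edge move, each by at most half of that edge's
  difference.\<close>

lemma acca_kernel_displacement:
  assumes N: "N \<ge> 2" and \<theta>': "\<theta>' \<in> set_pmf (acca_kernel N \<theta>)"
  shows "\<bar>wrap_pi (\<theta>' v - \<theta> v)\<bar> \<le> total_variation N \<theta>"
proof -
  have ne: "finite {1..N - 1}" "{1..N - 1} \<noteq> {}" using N by auto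
  from \<theta>' obtain k where k: "k \<in> {1..N - 1}" and step: "\<theta>' \<in> set_pmf (edge_step \<theta> k)"
    using ne by (auto simp: acca_kernel_eq_bind)
  have D: "\<bar>delta \<theta> k\<bar> \<le> total_variation N \<theta>"
    unfolding total_variation_def using k by (intro member_le_sum) auto
  from step show ?thesis
  proof (rule edge_step_cases)
    fix h m
    assume h: "\<bar>h\<bar> = \<bar>delta \<theta> k\<bar> / 2" and m: "wrap_pi m = wrap_pi (\<theta> k + h)"
      "wrap_pi m = wrap_pi (\<theta> (k + 1) - h)" and \<theta>': "\<theta>' = \<theta>(k := m, k + 1 := m)"
    have "wrap_pi (m - \<theta> k) = wrap_pi h"
      using wrap_pi_diff_left[of m "\<theta> k"] by (simp add: m(1))
    moreover have "wrap_pi (m - \<theta> (k + 1)) = wrap_pi (- h)"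
      using wrap_pi_diff_left[of m "\<theta> (k + 1)"] by (simp add: m(2))
    ultimately have "\<bar>wrap_pi (\<theta>' v - \<theta> v)\<bar> \<le> \<bar>h\<bar>"
      using abs_wrap_pi_le[of h] abs_wrap_pi_le[of "- h"] by (simp add: \<theta>')
    then show ?thesis using h D by linarith
  qed
qed

text \<open>Finite histories are recorded as lists with the most recent state first.\<close>

definition history :: "(nat \<Rightarrow> 'b) \<Rightarrow> nat \<Rightarrow> 'b list" where
  "history x t = rev (map x [0..<Suc t])"

lemma history_0 [simp]: "history x 0 = [x 0]"
  by (simp add: history_def)

lemma history_Suc [simp]: "history x (Suc t) = x (Suc t) # history x t"
  by (simp add: history_def)

lemma hd_history [simp]: "hd (history x t) = x t"
  by (cases t) simp_all

lemma history_eq_iff: "history x t = history y t \<longleftrightarrow> (\<forall>s\<le>t. x s = y s)"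
  by (auto simp: history_def less_Suc_eq_le)

text \<open>The joint law of the first \<open>t + 1\<close> states of a chain with kernel
  \<open>K\<close>. As the newest state comes first, a transition is a cons and the kernel is
  applied to the head.\<close>

primrec history_pmf :: "('b \<Rightarrow> 'b pmf) \<Rightarrow> 'b \<Rightarrow> nat \<Rightarrow> 'b list pmf" where
  "history_pmf K x0 0 = return_pmf [x0]"
| "history_pmf K x0 (Suc t) =
    bind_pmf (history_pmf K x0 t) (\<lambda>xs. map_pmf (\<lambda>y. y # xs) (K (hd xs)))"

text \<open>The list \<open>y # xs\<close> can only arise by extending \<open>xs\<close>, so a
  single term of the mixture over earlier histories survives.\<close>

lemma pmf_history_pmf_Suc:
  "pmf (history_pmf K x0 (Suc t)) (y # xs) = pmf (history_pmf K x0 t) xs * pmf (K (hd xs)) y"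
proof -
  have "pmf (map_pmf (\<lambda>y. y # zs) (K (hd zs))) (y # xs)
      = indicator {xs} zs * pmf (K (hd xs)) y" for zs
  proof (cases "zs = xs")
    case True
    then show ?thesis using pmf_map_inj'[of "\<lambda>y. y # xs"] by (simp add: inj_def)
  next
    case False
    then show ?thesis by (auto simp: pmf_eq_0_set_pmf)
  qed
  then show ?thesis by (simp add: pmf_bind measure_pmf_single)
qed

text \<open>Translates lists in the support back to sequences, the form in which the Markov property
  is given.\<close>

lemma history_pmf_is_history:
  assumes "xs \<in> set_pmf (history_pmf K x0 t)"
  shows "\<exists>x. xs = history x t"
  using assms
proof (induction t arbitrary: xs)
  case 0
  then show ?case by (intro exI[of _ "\<lambda>_. x0"]) simp
next
  case (Suc t)
  then obtain y x where "xs = y # history x t" by auto blast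
  then have "xs = history (x(Suc t := y)) (Suc t)"
    using history_eq_iff[of x t "x(Suc t := y)"] by simp
  then show ?case by blast
qed

section \<open>Transfer of discrete laws to the probability space\<close>

lemma measure_history_eq:
  assumes start: "measure M {\<omega> \<in> space M. X 0 \<omega> = x0} = 1" and M: "prob_space M"
    and meas: "\<And>x. {\<omega> \<in> space M. X 0 \<omega> = x} \<in> sets M"
    and step: "\<And>t x. measure M {\<omega> \<in> space M. \<forall>s\<le>Suc t. X s \<omega> = x s} =
        measure M {\<omega> \<in> space M. \<forall>s\<le>t. X s \<omega> = x s} * pmf (K (x t)) (x (Suc t))"
  shows "measure M {\<omega> \<in> space M. \<forall>s\<le>t. X s \<omega> = x s} = pmf (history_pmf K x0 t) (history x t)"
\<comment> \<open>Both sides satisfy the same recursion, so only the initial law needs an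
  argument.\<close>
proof (induction t)
  case 0
  interpret prob_space M by fact
  show ?case
  proof (cases "x 0 = x0")
    case True
    then show ?thesis using start by simp
  next
    case False
    \<comment> \<open>The events for two distinct initial states are disjoint, and one of them
      already has probability 1.\<close>
    then have "prob {\<omega> \<in> space M. X 0 \<omega> = x 0} + prob {\<omega> \<in> space M. X 0 \<omega> = x0}
        = prob ({\<omega> \<in> space M. X 0 \<omega> = x 0} \<union> {\<omega> \<in> space M. X 0 \<omega> = x0})"
      using meas by (intro finite_measure_Union[symmetric]) auto
    also have "\<dots> \<le> 1" by simp
    finally have "prob {\<omega> \<in> space M. X 0 \<omega> = x 0} = 0"
      using start by (simp add: measure_le_0_iff)
    then show ?thesis using False by simp
  qed
next
  case (Suc t)
  then show ?case by (simp only: step history_Suc pmf_history_pmf_Suc hd_history)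
qed

text \<open>The countably many atoms in the support exhaust the total mass, so
  \<open>f (Y \<omega>)\<close> agrees almost everywhere with a countable sum over atoms, which is
  integrated term by term. Only the events \<open>Y \<omega> = x\<close> enter, hence no measurable
  space of histories has to be chosen.\<close>

lemma (in prob_space) discrete_law:
  assumes meas: "\<And>x. x \<in> set_pmf q \<Longrightarrow> {\<omega> \<in> space M. Y \<omega> = x} \<in> sets M"
    and law: "\<And>x. x \<in> set_pmf q \<Longrightarrow> prob {\<omega> \<in> space M. Y \<omega> = x} = pmf q x"
  shows "AE \<omega> in M. Y \<omega> \<in> set_pmf q"
    and "(\<integral>\<^sup>+ \<omega>. f (Y \<omega>) \<partial>M) = (\<integral>\<^sup>+ x. f x \<partial>measure_pmf q)"
proof -
  have ind: "(\<lambda>\<omega>. g x * indicator {\<omega> \<in> space M. Y \<omega> = x} \<omega>) \<in> borel_measurable M"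
    if "x \<in> set_pmf q" for x and g :: "_ \<Rightarrow> ennreal" using meas[OF that] by measurable
  \<comment> \<open>Exchanges the integral with the countable sum over the support.\<close>
  have sum: "(\<integral>\<^sup>+ \<omega>. (\<integral>\<^sup>+ x. g x * indicator {\<omega> \<in> space M. Y \<omega> = x} \<omega> \<partial>count_space (set_pmf q)) \<partial>M)
      = (\<integral>\<^sup>+ x. g x \<partial>measure_pmf q)" for g :: "_ \<Rightarrow> ennreal"
  proof -
    have "(\<integral>\<^sup>+ \<omega>. (\<integral>\<^sup>+ x. g x * indicator {\<omega> \<in> space M. Y \<omega> = x} \<omega> \<partial>count_space (set_pmf q)) \<partial>M)
      = (\<integral>\<^sup>+ x. (\<integral>\<^sup>+ \<omega>. g x * indicator {\<omega> \<in> space M. Y \<omega> = x} \<omega> \<partial>M) \<partial>count_space (set_pmf q))"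
      using ind by (intro nn_integral_count_space_nn_integral) auto
    also have "\<dots> = (\<integral>\<^sup>+ x. g x * ennreal (pmf q x) \<partial>count_space (set_pmf q))"
      using meas law by (intro nn_integral_cong) (simp add: nn_integral_cmult_indicator emeasure_eq_measure)
    also have "\<dots> = (\<integral>\<^sup>+ x. g x \<partial>measure_pmf q)"
      by (subst nn_integral_measure_pmf)
        (auto simp: nn_integral_count_space_indicator indicator_def mult.commute set_pmf_iff
          intro!: nn_integral_cong)
    finally show ?thesis .
  qed
  \<comment> \<open>Pointwise, only the atom at \<open>Y \<omega>\<close> contributes, and nothing
    does if \<open>Y \<omega>\<close> lies outside the support.\<close>
  have single: "(\<integral>\<^sup>+ x. g x * indicator {\<omega> \<in> space M. Y \<omega> = x} \<omega> \<partial>count_space (set_pmf q))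
      = g (Y \<omega>) * indicator (set_pmf q) (Y \<omega>)" if "\<omega> \<in> space M" for \<omega> and g :: "_ \<Rightarrow> ennreal"
  proof -
    have "(\<integral>\<^sup>+ x. g x * indicator {\<omega> \<in> space M. Y \<omega> = x} \<omega> \<partial>count_space (set_pmf q))
        = (\<integral>\<^sup>+ x. g x * indicator {\<omega> \<in> space M. Y \<omega> = x} \<omega> * indicator (set_pmf q) x
            \<partial>count_space UNIV)"
      by (rule nn_integral_count_space_indicator) simp
    also have "\<dots>
        = (\<integral>\<^sup>+ x. (g (Y \<omega>) * indicator (set_pmf q) (Y \<omega>)) * indicator {Y \<omega>} x \<partial>count_space UNIV)"
    proof (intro nn_integral_cong)
      fix x
      show "g x * indicator {\<omega> \<in> space M. Y \<omega> = x} \<omega> * indicator (set_pmf q) x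
          = g (Y \<omega>) * indicator (set_pmf q) (Y \<omega>) * indicator {Y \<omega>} x"
        using that by (cases "x = Y \<omega>") simp_all
    qed
    also have "\<dots> = g (Y \<omega>) * indicator (set_pmf q) (Y \<omega>)"
      by (subst nn_integral_cmult_indicator) auto
    finally show ?thesis .
  qed
  have A: "{\<omega> \<in> space M. Y \<omega> \<in> set_pmf q} \<in> sets M"
  proof -
    have "{\<omega> \<in> space M. Y \<omega> \<in> set_pmf q} = (\<Union>x\<in>set_pmf q. {\<omega> \<in> space M. Y \<omega> = x})" by auto
    then show ?thesis using meas by (auto intro!: sets.countable_UN')
  qed
  \<comment> \<open>The case \<open>g = 1\<close> of the exchange computes the mass of the
    support.\<close>
  have "emeasure M {\<omega> \<in> space M. Y \<omega> \<in> set_pmf q}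
      = (\<integral>\<^sup>+ \<omega>. indicator {\<omega> \<in> space M. Y \<omega> \<in> set_pmf q} \<omega> \<partial>M)"
    using A by simp
  also have "\<dots> = 1"
    using sum[of "\<lambda>_. 1"] single[of _ "\<lambda>_. 1"]
    by (simp add: indicator_def cong: nn_integral_cong)
  finally have "prob {\<omega> \<in> space M. Y \<omega> \<in> set_pmf q} = 1"
    by (simp add: measure_def)
  from prob_Collect_eq_1[OF A] this show AE: "AE \<omega> in M. Y \<omega> \<in> set_pmf q" by simp
  have "(\<integral>\<^sup>+ \<omega>. f (Y \<omega>) \<partial>M)
      = (\<integral>\<^sup>+ \<omega>. (\<integral>\<^sup>+ x. f x * indicator {\<omega> \<in> space M. Y \<omega> = x} \<omega> \<partial>count_space (set_pmf q)) \<partial>M)"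
    using AE AE_space by (intro nn_integral_cong_AE, eventually_elim) (simp add: single)
  then show "(\<integral>\<^sup>+ \<omega>. f (Y \<omega>) \<partial>M) = (\<integral>\<^sup>+ x. f x \<partial>measure_pmf q)"
    by (simp only: sum)
qed

section \<open>Convergence on the circle from summable increments\<close>

lemma summable_circle_increments:
  assumes incr: "\<And>t. \<bar>wrap_pi (x (Suc t) - x t)\<bar> \<le> d t" and d: "summable d"
  shows "(\<lambda>t. circle_dist (x t) (wrap_pi (x 0 + (\<Sum>s. wrap_pi (x (Suc s) - x s))))) \<longlonglongrightarrow> 0"
proof -
  define g where "g s = wrap_pi (x (Suc s) - x s)" for s
  \<comment> \<open>\<open>u\<close> lifts the path \<open>x\<close> to the real line. Its
    increments are dominated by \<open>d\<close>, so it converges, and distances on the circle are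
    at most those of the lift. The explicit limit later makes measurability of the consensus value
    evident.\<close>
  define u where "u t = x 0 + (\<Sum>s<t. g s)" for t
  \<comment> \<open>Arbitrary \<open>c\<close> lets the induction hypothesis be used at
    \<open>c - g t\<close>.\<close>
  have lift: "wrap_pi (u t - c) = wrap_pi (x t - c)" for t c
  proof (induction t arbitrary: c)
    case 0
    then show ?case by (simp add: u_def)
  next
    case (Suc t)
    have "wrap_pi (u (Suc t) - c) = wrap_pi (u t - (c - g t))"
      by (simp add: u_def algebra_simps)
    also have "\<dots> = wrap_pi ((x t - c) + wrap_pi (x (Suc t) - x t))"
      unfolding Suc by (simp add: g_def algebra_simps)
    also have "\<dots> = wrap_pi (x (Suc t) - c)" by simp
    finally show ?case .
  qed
  have "summable g"
    using incr by (intro summable_comparison_test'[OF d, of 0]) (simp add: g_def)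
  then have "(\<lambda>t. \<Sum>s<t. g s) \<longlonglongrightarrow> suminf g" by (rule summable_LIMSEQ)
  then have "(\<lambda>t. \<bar>(\<Sum>s<t. g s) - suminf g\<bar>) \<longlonglongrightarrow> 0"
    by (intro tendsto_rabs_zero) (rule LIM_zero)
  then have "(\<lambda>t. \<bar>u t - (x 0 + suminf g)\<bar>) \<longlonglongrightarrow> 0" by (simp add: u_def)
  moreover have "circle_dist (x t) (wrap_pi (x 0 + suminf g)) \<le> \<bar>u t - (x 0 + suminf g)\<bar>" for t
    using abs_wrap_pi_le[of "u t - (x 0 + suminf g)"] by (simp add: circle_dist_def lift)
  ultimately have "(\<lambda>t. circle_dist (x t) (wrap_pi (x 0 + suminf g))) \<longlonglongrightarrow> 0"
    by (elim Lim_null_comparison[rotated]) (simp add: circle_dist_def)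
  then show ?thesis by (simp add: g_def[abs_def])
qed

lemma circle_dist_neighbour: "circle_dist (\<theta> (Suc v)) a \<le> circle_dist (\<theta> v) a + \<bar>delta \<theta> v\<bar>"
  using abs_wrap_pi_add[of "\<theta> v - a" "\<theta> (Suc v) - \<theta> v"]
  by (simp add: circle_dist_def delta_def)

section \<open>Measurability of configurations\<close>

lemma config_singleton_measurable:
  assumes "X \<in> measurable M (config_space N)"
  shows "{\<omega> \<in> space M. X \<omega> = x} \<in> sets M"
proof -
  \<comment> \<open>A point of the space is a finite box of singletons; for any other
    \<open>x\<close> the intersection is empty.\<close>
  have "{x} \<inter> space (config_space N) \<in> sets (config_space N)"
  proof (cases "x \<in> space (config_space N)")
    case True
    then have x: "x \<in> {1..N} \<rightarrow>\<^sub>E circle"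
      by (simp add: config_space_def space_PiM circle_borel_def space_restrict_space)
    then have "{i} \<in> sets circle_borel" if "i \<in> x ` {1..N}" for i
      using that by (auto simp: circle_borel_def sets_restrict_space_iff)
    then have "(\<Pi>\<^sub>E i\<in>{1..N}. {x i}) \<in> sets (config_space N)"
      unfolding config_space_def by (intro sets_PiM_I_finite) auto
    moreover have "(\<Pi>\<^sub>E i\<in>{1..N}. {x i}) = {x}"
      using x by (intro PiE_singleton) (simp add: PiE_iff)
    ultimately show ?thesis using True by simp
  qed simp
  from measurable_sets[OF assms this] have "X -` ({x} \<inter> space (config_space N)) \<inter> space M \<in> sets M" .
  also have "X -` ({x} \<inter> space (config_space N)) \<inter> space M = {\<omega> \<in> space M. X \<omega> = x}"
    using measurable_space[OF assms] by auto
  finally show ?thesis .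
qed

lemma config_coordinate_measurable:
  assumes "X \<in> measurable M (config_space N)" "i \<in> {1..N}"
  shows "(\<lambda>\<omega>. X \<omega> i) \<in> borel_measurable M"
proof -
  have "(\<lambda>\<omega>. X \<omega> i) \<in> measurable M circle_borel"
    using assms unfolding config_space_def by measurable
  then show ?thesis
    unfolding circle_borel_def by (simp add: measurable_restrict_space2_iff)
qed

theorem lemma3p1:
  fixes M :: "'a measure" and N :: nat
    and \<theta>0 :: "nat \<Rightarrow> real" and X :: "nat \<Rightarrow> 'a \<Rightarrow> nat \<Rightarrow> real"
  assumes "N \<ge> 2"
    and "\<theta>0 \<in> configs N"
    and "acca_dynamics M N \<theta>0 X"
  shows "(AE \<omega> in M. (\<lambda>t. \<Sum>i = 1..N - 1. \<bar>delta (X t \<omega>) i\<bar>) \<longlonglongrightarrow> 0)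
    \<and> strong_consensus M N X"
proof -
  interpret prob_space M using assms(3) by (simp add: acca_dynamics_def)
  let ?K = "acca_kernel N" and ?D = "total_variation N" and ?W = "potential N"
  let ?Q = "history_pmf ?K \<theta>0"
  let ?H = "\<lambda>t \<omega>. history (\<lambda>s. X s \<omega>) t"
  have N: "N \<ge> 2" by fact
  have X: "X t \<in> measurable M (config_space N)" for t
    using assms(3) by (simp add: acca_dynamics_def)
  note single = config_singleton_measurable[OF X]
  have coord: "(\<lambda>\<omega>. X t \<omega> i) \<in> borel_measurable M" if "i \<in> {1..N}" for t i
    using config_coordinate_measurable[OF X that] .
  have delta_meas: "(\<lambda>\<omega>. delta (X t \<omega>) i) \<in> borel_measurable M" if "i \<in> {1..N - 1}" for t i
  proof -
    have [measurable]: "(\<lambda>\<omega>. X t \<omega> i) \<in> borel_measurable M"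
        "(\<lambda>\<omega>. X t \<omega> (i + 1)) \<in> borel_measurable M"
      using coord[of i] coord[of "i + 1"] that by auto
    show ?thesis unfolding delta_def by measurable
  qed
  have D_meas [measurable]: "(\<lambda>\<omega>. ?D (X t \<omega>)) \<in> borel_measurable M" for t
    unfolding total_variation_def using delta_meas by (intro borel_measurable_sum) auto

  \<comment> \<open>Law of the finite histories\<close>
  have "prob {\<omega> \<in> space M. X 0 \<omega> = \<theta>0} = 1"
    using assms(3) prob_Collect_eq_1[OF single] by (simp add: acca_dynamics_def)
  then have law: "prob {\<omega> \<in> space M. \<forall>s\<le>t. X s \<omega> = x s} = pmf (?Q t) (history x t)" for t x
    using assms(3) single
    by (intro measure_history_eq prob_space_axioms) (auto simp: acca_dynamics_def)
  have hist: "{\<omega> \<in> space M. ?H t \<omega> = xs} \<in> sets M \<and>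
      prob {\<omega> \<in> space M. ?H t \<omega> = xs} = pmf (?Q t) xs" if Q: "xs \<in> set_pmf (?Q t)" for t xs
  proof -
    obtain x where xs: "xs = history x t" using history_pmf_is_history[OF Q] by blast
    have "{\<omega> \<in> space M. \<forall>s\<in>{..t}. X s \<omega> = x s} \<in> sets M"
      using single by (intro sets.sets_Collect_finite_All) auto
    then have "{\<omega> \<in> space M. \<forall>s\<le>t. X s \<omega> = x s} \<in> sets M"
      by (simp only: Ball_def atMost_iff)
    then show ?thesis
      unfolding xs history_eq_iff using law[of t x] by blast
  qed
  have hist_AE: "AE \<omega> in M. ?H t \<omega> \<in> set_pmf (?Q t)" for t
    using hist by (intro discrete_law) auto
  have expect: "(\<integral>\<^sup>+ \<omega>. f (X t \<omega>) \<partial>M) = (\<integral>\<^sup>+ xs. f (hd xs) \<partial>?Q t)"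
    for f :: "_ \<Rightarrow> ennreal" and t
    using discrete_law(2)[of "?Q t" "?H t" "\<lambda>xs. f (hd xs)"] hist by simp

  \<comment> \<open>Almost sure summability of the total variation\<close>
  have "(\<Sum>s<t. \<integral>\<^sup>+ \<omega>. ennreal (?D (X s \<omega>) / real (N - 1)) \<partial>M)
      + (\<integral>\<^sup>+ \<omega>. ennreal (?W (X t \<omega>)) \<partial>M) \<le> ennreal (?W \<theta>0)" for t
  proof (induction t)
    case 0
    then show ?case by (simp add: expect[of "\<lambda>x. ennreal (?W x)"])
  next
    case (Suc t)
    \<comment> \<open>A history up to \<open>Suc t\<close> is one up to \<open>t\<close> followed by
      a draw from the kernel, so the expectation of the next potential is an iterated integral to
      which the drift inequality applies pointwise.\<close>
    have "(\<integral>\<^sup>+ \<omega>. ennreal (?D (X t \<omega>) / real (N - 1)) \<partial>M) + (\<integral>\<^sup>+ \<omega>. ennreal (?W (X (Suc t) \<omega>)) \<partial>M)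
        = (\<integral>\<^sup>+ xs. (\<integral>\<^sup>+ y. ennreal (?W y) \<partial>?K (hd xs)) + ennreal (?D (hd xs) / real (N - 1)) \<partial>?Q t)"
      unfolding expect[of "\<lambda>x. ennreal (?W x)"] expect[of "\<lambda>x. ennreal (?D x / real (N - 1))"]
      by (simp add: nn_integral_add add.commute)
    also have "\<dots> \<le> (\<integral>\<^sup>+ xs. ennreal (?W (hd xs)) \<partial>?Q t)"
      by (intro nn_integral_mono nn_integral_potential_kernel N)
    also have "\<dots> = (\<integral>\<^sup>+ \<omega>. ennreal (?W (X t \<omega>)) \<partial>M)"
      by (simp add: expect[of "\<lambda>x. ennreal (?W x)"])
    finally show ?case
      using Suc by (simp add: add.assoc) (meson add_left_mono order_trans)
  qed
  then have partial: "(\<Sum>s<t. \<integral>\<^sup>+ \<omega>. ennreal (?D (X s \<omega>) / real (N - 1)) \<partial>M) \<le> ennreal (?W \<theta>0)" for t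
    by (meson le_iff_add order_trans)
  have "(\<integral>\<^sup>+ \<omega>. (\<Sum>t. ennreal (?D (X t \<omega>) / real (N - 1))) \<partial>M)
      = (\<Sum>t. \<integral>\<^sup>+ \<omega>. ennreal (?D (X t \<omega>) / real (N - 1)) \<partial>M)"
    by (intro nn_integral_suminf) measurable
  also have "\<dots> \<le> ennreal (?W \<theta>0)"
    using partial by (intro suminf_le_const) auto
  finally have "(\<integral>\<^sup>+ \<omega>. (\<Sum>t. ennreal (?D (X t \<omega>) / real (N - 1))) \<partial>M) \<noteq> \<infinity>"
    by (auto simp: top_unique)
  \<comment> \<open>A nonnegative function with finite integral is finite almost everywhere.\<close>
  then have "AE \<omega> in M. (\<Sum>t. ennreal (?D (X t \<omega>) / real (N - 1))) \<noteq> \<infinity>"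
    by (intro nn_integral_PInf_AE) measurable
  then have summable: "AE \<omega> in M. summable (\<lambda>t. ?D (X t \<omega>))"
  proof eventually_elim
    case (elim \<omega>)
    then have "summable (\<lambda>t. ?D (X t \<omega>) / real (N - 1))"
      by (intro summable_suminf_not_top) (auto simp: total_variation_nonneg)
    then have "summable (\<lambda>t. ?D (X t \<omega>) / real (N - 1) * real (N - 1))" by (rule summable_mult2)
    then show ?case using N by simp
  qed

  have "AE \<omega> in M. \<forall>t. ?H (Suc t) \<omega> \<in> set_pmf (?Q (Suc t))"
    using hist_AE by (simp only: AE_all_countable) blast
  \<comment> \<open>Membership of a history in the support includes that its last transition has
    positive probability.\<close>
  then have move: "AE \<omega> in M. \<forall>t. X (Suc t) \<omega> \<in> set_pmf (?K (X t \<omega>))"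
    by eventually_elim auto

  \<comment> \<open>The common limit of all vertices\<close>
  define L where "L \<omega> = wrap_pi (X 0 \<omega> 1 + (\<Sum>s. wrap_pi (X (Suc s) \<omega> 1 - X s \<omega> 1)))" for \<omega>
  have L: "L \<in> measurable M circle_borel"
  proof -
    have [measurable]: "(\<lambda>\<omega>. X t \<omega> 1) \<in> borel_measurable M" for t
      using coord[of 1] N by auto
    have "L \<in> borel_measurable M" unfolding L_def by measurable
    then show ?thesis unfolding circle_borel_def
      using wrap_pi_in_circle by (intro measurable_restrict_space2) (auto simp: L_def)
  qed
  have "AE \<omega> in M. \<forall>v\<in>{1..N}. (\<lambda>t. circle_dist (X t \<omega> v) (L \<omega>)) \<longlonglongrightarrow> 0"
    using summable move
  proof eventually_elim
    case (elim \<omega>)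
    have D0: "(\<lambda>t. ?D (X t \<omega>)) \<longlonglongrightarrow> 0" using elim(1) by (rule summable_LIMSEQ_zero)
    \<comment> \<open>Vertex 1 converges because its increments are bounded by the summable total
      variations; the limit is then passed from each vertex to the next, as the difference along the
      edge between them tends to 0.\<close>
    have "(\<lambda>t. circle_dist (X t \<omega> v) (L \<omega>)) \<longlonglongrightarrow> 0" if "1 \<le> v" "v \<le> N" for v
      using that
    proof (induction v rule: dec_induct)
      case base
      show ?case unfolding L_def
        using elim acca_kernel_displacement[OF N] by (intro summable_circle_increments) auto
    next
      case (step v)
      have "circle_dist (X t \<omega> (Suc v)) (L \<omega>) \<le> circle_dist (X t \<omega> v) (L \<omega>) + ?D (X t \<omega>)" for t
      proof -
        have "\<bar>delta (X t \<omega>) v\<bar> \<le> ?D (X t \<omega>)"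
          unfolding total_variation_def using step by (intro member_le_sum) auto
        then show ?thesis using circle_dist_neighbour[of "X t \<omega>" v "L \<omega>"] by linarith
      qed
      moreover have "(\<lambda>t. circle_dist (X t \<omega> v) (L \<omega>) + ?D (X t \<omega>)) \<longlonglongrightarrow> 0"
        using tendsto_add[OF step.IH D0] step by simp
      ultimately show ?case
        by (elim Lim_null_comparison[rotated]) (simp add: circle_dist_def)
    qed
    then show ?case by auto
  qed
  with L have "strong_consensus M N X" by (auto simp: strong_consensus_def)
  moreover have "AE \<omega> in M. (\<lambda>t. \<Sum>i = 1..N - 1. \<bar>delta (X t \<omega>) i\<bar>) \<longlonglongrightarrow> 0"
    using summable
    by eventually_elim (simp only: summable_LIMSEQ_zero total_variation_def[symmetric])
  ultimately show ?thesis by blast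
qed

end
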